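(* Let $n \in \mathbb{N}$, $m \in \{0,\ldots,n-1\}$, $m < s \le n$, and $0 < \alpha \le 1$. Then there is a constant $c = c(n,m,s,\alpha) > 0$ such that for every $A \subset \mathbb{R}^n$ with $\mathcal{P}^s(A) < \infty$ it holds that \[ \limsup_{r \downarrow 0} \inf_{\theta \in S^{n-1},\, V \in G(n,n-m)} \frac{\mathcal{P}^s\bigl( A \cap X(x,r,V,\alpha) \setminus H(x,\theta,\alpha) \bigr)}{(2r)^s} \ge c \] for $\mathcal{P}^s$-almost every $x \in A$.
   Context: $G(n,n-m)$ denotes the space of all $(n-m)$-dimensional linear subspaces of $\mathbb{R}^n$, and $S^{n-1}$ is the unit sphere of $\mathbb{R}^n$. For $x \in \mathbb{R}^n$, $\theta \in S^{n-1}$, $0<\alpha\le 1$, $r>0$ and $V \in G(n,n-m)$: $H(x,\theta,\alpha) = \{ y \in \mathbb{R}^n : (y-x)\cdot\theta > \alpha|y-x| \}$, $X(x,V,\alpha) = \{ y \in \mathbb{R}^n : \operatorname{dist}(y-x,V) < \alpha|y-x| \}$, $X(x,r,V,\alpha) = B(x,r) \cap X(x,V,\alpha)$, where $B(x,r)$ is the closed ball centered at $x$ with radius $r$. $\mathcal{P}^s$ denotes the $s$-dimensional packing measure on $\mathbb{R}^n$: first the packing premeasure $P^s_0(E) = \lim_{\delta \downarrow 0} \sup \{ \sum_i (2r_i)^s : \{B(x_i,r_i)\}_i \text{ pairwise disjoint closed balls}, x_i \in E, r_i \le \delta \}$, and then $\mathcal{P}^s(E) = \inf\{ \sum_i P^s_0(E_i)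 : E \subset \bigcup_i E_i \}$ (the standard construction as in Mattila, Geometry of Sets and Measures in Euclidean Spaces). The constant $c$ depends only on $n,m,s,\alpha$. *)

theory Defs
  imports "HOL-Analysis.Analysis"
begin

definition Hcone :: "'a::euclidean_space \<Rightarrow> 'a \<Rightarrow> real \<Rightarrow> 'a set" where
  "Hcone x \<theta> \<alpha> = {y. (y - x) \<bullet> \<theta> > \<alpha> * norm (y - x)}"

definition Xcone :: "'a::euclidean_space \<Rightarrow> 'a set \<Rightarrow> real \<Rightarrow> 'a set" where
  "Xcone x V \<alpha> = {y. infdist (y - x) V < \<alpha> * norm (y - x)}"

definition Xcone_r :: "'a::euclidean_space \<Rightarrow> real \<Rightarrow> 'a set \<Rightarrow> real \<Rightarrow> 'a set" where
  "Xcone_r x r V \<alpha> = cball x r \<inter> Xcone x V \<alpha>"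

definition grassmannian :: "nat \<Rightarrow> 'a::euclidean_space set set" where
  "grassmannian k = {V. subspace V \<and> dim V = k}"

text \<open>Packing premeasure: the limit as delta decreases to 0 of the (monotone in delta)
  supremum over countable packings by pairwise disjoint closed balls centred in E
  with radii at most delta. The packing is indexed by a set I of naturals.\<close>

definition packing_sum :: "real \<Rightarrow> nat set \<Rightarrow> (nat \<Rightarrow> real) \<Rightarrow> ennreal" where
  "packing_sum s I \<rho> = (\<Sum>i. if i \<in> I then ennreal ((2 * \<rho> i) powr s) else 0)"

definition packings :: "'a::euclidean_space set \<Rightarrow> real \<Rightarrow> (nat set \<times> (nat \<Rightarrow> 'a) \<times> (nat \<Rightarrow> real)) set" where
  "packings E \<delta> = {(I, c, \<rho>). (\<forall>i\<in>I. c i \<in> E \<and> 0 < \<rho> i \<and> \<rho> i \<le> \<delta>) \<and>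
      (\<forall>i\<in>I. \<forall>j\<in>I. i \<noteq> j \<longrightarrow> cball (c i) (\<rho> i) \<inter> cball (c j) (\<rho> j) = {})}"

definition packing_premeasure :: "real \<Rightarrow> 'a::euclidean_space set \<Rightarrow> ennreal" where
  "packing_premeasure s E =
     (INF \<delta>\<in>{0<..}. SUP p\<in>packings E \<delta>. packing_sum s (fst p) (snd (snd p)))"

definition packing_measure :: "real \<Rightarrow> 'a::euclidean_space set \<Rightarrow> ennreal" where
  "packing_measure s E =
     (INF Es\<in>{Es :: nat \<Rightarrow> 'a set. E \<subseteq> (\<Union>i. Es i)}. \<Sum>i. packing_premeasure s (Es i))"

end

theory Submission
  imports Defs
begin

text \<open>
  Almost every point of \<open>A\<close> has positive lower density: small balls centred at \<open>x \<in> A\<close> have measure at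
  least a constant times \<open>r powr s\<close>. Suppose that, on a subset \<open>E\<close>, the infimum over cones is below
  \<open>c\<close> at all small scales, and fix such a scale \<open>r\<close>. Sort the points of \<open>E\<close> in a ball of radius \<open>r\<close> by
  approximate \<open>(\<theta>, V)\<close> of their bad cone (boundedly many classes), and by a strip of width \<open>r / N\<close>
  around a translate of \<open>V\<close> (at most \<open>(3 N) ^ m\<close> strips). Two points of one class in one strip are at
  distance \<open>O(r / N)\<close>, since otherwise the cone at one of them would contain the ball of radius
  \<open>r / N\<close> around the other, which has too large measure. So \<open>O(N ^ m)\<close> balls of radius \<open>O(r / N)\<close>
  cover \<open>E\<close> in each ball of radius \<open>r\<close>. As \<open>m < s\<close>, for large \<open>N\<close> this forces the packing
  premeasure of bounded parts of \<open>E\<close> to vanish.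
\<close>

section \<open>Packing measure as an outer measure\<close>

lemma packings_mono: "E \<subseteq> F \<Longrightarrow> packings E \<delta> \<subseteq> packings F \<delta>"
  unfolding packings_def by auto

lemma packing_premeasure_mono:
  assumes "E \<subseteq> F"
  shows "packing_premeasure s E \<le> packing_premeasure s F"
  unfolding packing_premeasure_def
  using packings_mono[OF assms] by (intro INF_mono) (blast intro: SUP_subset_mono)

lemma packing_premeasure_empty [simp]: "packing_premeasure s {} = 0"
proof -
  have "packing_sum s (fst p) (snd (snd p)) = 0" if "p \<in> packings ({} :: 'a set) \<delta>" for p \<delta>
    using that by (auto simp: packings_def packing_sum_def)
  then have "(SUP p\<in>packings ({} :: 'a set) \<delta>. packing_sum s (fst p) (snd (snd p))) \<le> 0" for \<delta>
    by (intro SUP_least) simp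
  then show ?thesis
    unfolding packing_premeasure_def
    by (metis (no_types, lifting) INF_lower2 greaterThan_iff le_zero_eq zero_less_one)
qed

lemma packing_measure_le_suminf:
  "E \<subseteq> (\<Union>i. Es i) \<Longrightarrow> packing_measure s E \<le> (\<Sum>i. packing_premeasure s (Es i))"
  unfolding packing_measure_def by (intro INF_lower) simp

lemma packing_measure_le_premeasure: "packing_measure s E \<le> packing_premeasure s E"
proof -
  have "packing_measure s E \<le> (\<Sum>i. packing_premeasure s (if i = 0 then E else {}))" 
    by (rule packing_measure_le_suminf) (auto split: if_splits)
  also have "\<dots> = (\<Sum>i\<in>{0::nat}. packing_premeasure s (if i = 0 then E else {}))"
    by (rule suminf_finite) auto
  finally show ?thesis by simp
qed

lemma packing_measure_empty [simp]: "packing_measure s {} = 0"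
  using packing_measure_le_premeasure[of s "{}"] by simp

lemma packing_measure_mono:
  assumes "E \<subseteq> F"
  shows "packing_measure s E \<le> packing_measure s F"
  unfolding packing_measure_def using assms by (intro INF_superset_mono) auto

text \<open>Near-optimal covers of the \<open>A n\<close>, with errors summing to \<open>e\<close>,
  are merged through \<open>prod_decode\<close> into one cover of the union.\<close>

lemma packing_measure_countably_subadditive:
  "packing_measure s (\<Union>i::nat. A i) \<le> (\<Sum>i. packing_measure s (A i))"
proof (rule ennreal_le_epsilon)
  fix e :: real
  assume e: "0 < e" and fin: "(\<Sum>n. packing_measure s (A n)) < top"
  \<comment> \<open>A finite sum has finite terms, so adding a positive error is a strict increase
    and the infimum supplies a cover below it.\<close>
  have "packing_measure s (A n) < packing_measure s (A n) + e * (1/2)^Suc n" for n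
    using e fin by (auto simp add: less_top dest!: ennreal_suminf_lessD)
  then have "\<exists>B. A n \<subseteq> (\<Union>i::nat. B i) \<and>
      (\<Sum>i. packing_premeasure s (B i)) < packing_measure s (A n) + e * (1/2)^Suc n" for n
    by (subst (asm) (1) packing_measure_def) (auto simp: INF_less_iff)
  then obtain B where B: "\<And>n. A n \<subseteq> (\<Union>i::nat. B n i)"
    and Ble: "\<And>n. (\<Sum>i. packing_premeasure s (B n i)) < packing_measure s (A n) + e * (1/2)^Suc n"
    by metis
  define C where "C = case_prod B \<circ> prod_decode"
  have "(\<Union>i. A i) \<subseteq> (\<Union>i. C i)"
    using B by (auto simp add: C_def subset_eq) (metis prod.case prod_encode_inverse)
  then have "packing_measure s (\<Union>i. A i) \<le> (\<Sum>i. packing_premeasure s (C i))"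
    by (rule packing_measure_le_suminf)
  also have "\<dots> = (\<Sum>n. \<Sum>i. packing_premeasure s (B n i))"
    unfolding C_def comp_def
    by (rule suminf_ennreal_2dimen[where f = "\<lambda>p. packing_premeasure s (case_prod B p)"]) simp
  also have "\<dots> \<le> (\<Sum>n. packing_measure s (A n) + e * (1/2) ^ Suc n)"
    using Ble by (intro suminf_le) (auto intro: less_imp_le)
  also have "\<dots> = (\<Sum>n. packing_measure s (A n)) + (\<Sum>n. ennreal e * ennreal ((1/2) ^ Suc n))"
    using e by (subst suminf_add[symmetric])
       (auto simp del: ennreal_suminf_cmult simp add: ennreal_mult[symmetric])
  also have "(\<Sum>n. ennreal e * ennreal ((1/2) ^ Suc n)) = e"
    unfolding ennreal_suminf_cmult
    by (subst suminf_ennreal_eq[OF zero_le_power power_half_series]) auto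
  finally show "packing_measure s (\<Union>i. A i) \<le> (\<Sum>n. packing_measure s (A n)) + e" .
qed

lemma packing_measure_UN_null:
  assumes "\<And>i::nat. packing_measure s (A i) = 0"
  shows "packing_measure s (\<Union>i. A i) = 0"
  using packing_measure_countably_subadditive[of s A] assms by simp

section \<open>Lower densities of packing measure\<close>

text \<open>The factor \<open>5 powr s\<close> lets the elementary \<open>5r\<close>-covering lemma replace the Vitali covering
  theorem for general measures, so that \<open>A\<close> need not be measurable.\<close>
lemma packing_measure_small_density_le:
  fixes A F :: "'a::euclidean_space set"
  assumes small: "\<And>x \<epsilon>. x \<in> F \<Longrightarrow> 0 < \<epsilon> \<Longrightarrow>
      \<exists>r>0. r < \<epsilon> \<and> packing_measure s (A \<inter> cball x r) < ennreal ((2 * r) powr s / (2 * 5 powr s))"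
    and "F \<subseteq> A"
  shows "2 * packing_measure s F \<le> packing_premeasure s F"
proof -
  have bound: "2 * packing_measure s F \<le> (SUP p\<in>packings F \<delta>. packing_sum s (fst p) (snd (snd p)))"
    if \<delta>: "0 < \<delta>" for \<delta> :: real
  proof -
    \<comment> \<open>The radii in \<open>K\<close> are one fifth of those of small-density balls,
      so the enlarged balls of the covering lemma are the ones of small measure; the factor
      \<open>5 powr s\<close> of the hypothesis cancels.\<close>
    define K where "K = {(x, r). x \<in> F \<and> 0 < r \<and> r \<le> \<delta> \<and>
      packing_measure s (A \<inter> cball x (5 * r)) < ennreal ((2 * r) powr s / 2)}"
    have "F \<subseteq> (\<Union>i\<in>K. cball (fst i) (snd i))"
    proof
      fix x assume x: "x \<in> F"
      obtain r where r: "0 < r" "r < 5 * \<delta>"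
        "packing_measure s (A \<inter> cball x r) < ennreal ((2 * r) powr s / (2 * 5 powr s))"
        using small[OF x, of "5 * \<delta>"] \<delta> by auto
      have "(2 * r) powr s = (2 * (r / 5)) powr s * 5 powr s"
        using r by (subst powr_mult[symmetric]) auto
      with r x have "(x, r / 5) \<in> K"
        by (simp add: K_def)
      then show "x \<in> (\<Union>i\<in>K. cball (fst i) (snd i))"
        using r by force
    qed
    moreover have "\<And>i. i \<in> K \<Longrightarrow> 0 < snd i \<and> snd i \<le> \<delta>"
      by (auto simp: K_def)
    ultimately obtain C where C: "countable C" "C \<subseteq> K"
      "pairwise (\<lambda>i j. disjnt (cball (fst i) (snd i)) (cball (fst j) (snd j))) C"
      "F \<subseteq> (\<Union>i\<in>C. cball (fst i) (5 * snd i))"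
      by (rule Vitali_covering_lemma_cballs)
    \<comment> \<open>The countable disjoint family is reindexed by naturals, the form that
      \<open>packings\<close> demands.\<close>
    define I where "I = to_nat_on C ` C"
    define g where "g = from_nat_into C"
    have g: "g i \<in> C" "g i \<in> K" if "i \<in> I" for i
      using that C by (auto simp: I_def g_def)
    have g_inj: "g i \<noteq> g j" if "i \<in> I" "j \<in> I" "i \<noteq> j" for i j
      using that C by (auto simp: I_def g_def)
    have pack: "(I, fst \<circ> g, snd \<circ> g) \<in> packings F \<delta>"
    proof -
      have "cball (fst (g i)) (snd (g i)) \<inter> cball (fst (g j)) (snd (g j)) = {}"
        if "i \<in> I" "j \<in> I" "i \<noteq> j" for i j
        using pairwiseD[OF C(3) g(1)[OF that(1)] g(1)[OF that(2)] g_inj[OF that]]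
        by (simp add: disjnt_def)
      moreover have "fst (g i) \<in> F \<and> 0 < snd (g i) \<and> snd (g i) \<le> \<delta>" if "i \<in> I" for i
        using g(2)[OF that] by (simp add: K_def split_beta)
      ultimately show ?thesis by (simp add: packings_def)
    qed
    \<comment> \<open>The enlarged balls cover \<open>F\<close>, and each meets \<open>A\<close> in
      measure at most half the packing term of its original ball; this is where the factor 2
      arises.\<close>
    define S where "S i = (if i \<in> I then A \<inter> cball (fst (g i)) (5 * snd (g i)) else {})" for i
    have "F \<subseteq> (\<Union>i. S i)"
    proof
      fix x assume x: "x \<in> F"
      then obtain p where p: "p \<in> C" "x \<in> cball (fst p) (5 * snd p)"
        using C(4) by auto
      have "g (to_nat_on C p) = p" "to_nat_on C p \<in> I"
        using p C(1) by (auto simp: g_def I_def)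
      then have "x \<in> S (to_nat_on C p)"
        using p x \<open>F \<subseteq> A\<close> by (auto simp: S_def)
      then show "x \<in> (\<Union>i. S i)" by blast
    qed
    then have "packing_measure s F \<le> packing_measure s (\<Union>i. S i)"
      by (rule packing_measure_mono)
    also have "\<dots> \<le> (\<Sum>i. packing_measure s (S i))"
      by (rule packing_measure_countably_subadditive)
    finally have "2 * packing_measure s F \<le> (\<Sum>i. 2 * packing_measure s (S i))"
      by (simp add: mult_left_mono)
    also have "\<dots> \<le> (\<Sum>i. if i \<in> I then ennreal ((2 * snd (g i)) powr s) else 0)"
    proof (rule suminf_le)
      fix i
      have "2 * ennreal ((2 * snd (g i)) powr s / 2) = ennreal ((2 * snd (g i)) powr s)"
        by (simp add: ennreal_mult[symmetric] flip: ennreal_numeral)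
      moreover have "packing_measure s (S i) \<le> ennreal ((2 * snd (g i)) powr s / 2)" if "i \<in> I"
        using g(2)[OF that] that by (auto simp: S_def K_def split_beta intro: less_imp_le)
      then have "2 * packing_measure s (S i) \<le> 2 * ennreal ((2 * snd (g i)) powr s / 2)" if "i \<in> I"
        using that by (intro mult_left_mono) auto
      ultimately show "2 * packing_measure s (S i)
          \<le> (if i \<in> I then ennreal ((2 * snd (g i)) powr s) else 0)"
        by (simp add: S_def)
    qed auto
    also have "\<dots> = packing_sum s I (snd \<circ> g)"
      by (simp add: packing_sum_def o_def)
    also have "\<dots> \<le> (SUP p\<in>packings F \<delta>. packing_sum s (fst p) (snd (snd p)))"
      by (intro SUP_upper2[OF pack]) auto
    finally show ?thesis .
  qed
  then show ?thesis
    unfolding packing_premeasure_def by (intro INF_greatest) simp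
qed

text \<open>On every subset of the exceptional set, twice the measure is at most the premeasure.
  Summing over an arbitrary cover gives
  \<open>2 * packing_measure s ?D \<le> packing_measure s ?D\<close>, which for a finite value
  forces 0.\<close>

lemma packing_measure_lower_density:
  fixes A :: "'a::euclidean_space set"
  assumes fin: "packing_measure s A < \<infinity>"
  shows "packing_measure s {x \<in> A. \<not> (\<exists>\<epsilon>>0. \<forall>r. 0 < r \<and> r < \<epsilon> \<longrightarrow>
    ennreal ((2 * r) powr s / (2 * 5 powr s)) \<le> packing_measure s (A \<inter> cball x r))} = 0"
    (is "packing_measure s ?D = 0")
proof -
  have half: "2 * packing_measure s F \<le> packing_premeasure s F" if "F \<subseteq> ?D" for F
    using that by (intro packing_measure_small_density_le[where A = A]) (force simp: not_le)+
  have "2 * packing_measure s ?D \<le> packing_measure s ?D"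
  \<comment> \<open>Only the right-hand measure is unfolded; each competing cover is cut down to
    \<open>?D\<close> so that \<open>half\<close> applies to its pieces.\<close>
  proof (subst (2) packing_measure_def, rule INF_greatest)
    fix Es :: "nat \<Rightarrow> 'a set"
    assume "Es \<in> {Es. ?D \<subseteq> (\<Union>i. Es i)}"
    then have "?D \<subseteq> (\<Union>i. ?D \<inter> Es i)" by blast
    then have "packing_measure s ?D \<le> packing_measure s (\<Union>i. ?D \<inter> Es i)"
      by (rule packing_measure_mono)
    also have "\<dots> \<le> (\<Sum>i. packing_measure s (?D \<inter> Es i))"
      by (rule packing_measure_countably_subadditive)
    finally have "2 * packing_measure s ?D \<le> (\<Sum>i. 2 * packing_measure s (?D \<inter> Es i))"
      by (simp add: mult_left_mono)
    also have "\<dots> \<le> (\<Sum>i. packing_premeasure s (Es i))"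
    proof (rule suminf_le)
      fix i
      have "2 * packing_measure s (?D \<inter> Es i) \<le> packing_premeasure s (?D \<inter> Es i)"
        by (rule half) auto
      also have "\<dots> \<le> packing_premeasure s (Es i)"
        by (rule packing_premeasure_mono) auto
      finally show "2 * packing_measure s (?D \<inter> Es i) \<le> \<dots>" .
    qed auto
    finally show "2 * packing_measure s ?D \<le> (\<Sum>i. packing_premeasure s (Es i))" .
  qed
  moreover have "packing_measure s ?D < top"
    using fin by (intro le_less_trans[OF packing_measure_mono[of ?D A]]) auto
  ultimately show ?thesis
    by (cases "packing_measure s ?D" rule: ennreal_cases)
      (auto simp: ennreal_mult[symmetric] simp flip: ennreal_numeral)
qed

section \<open>Sets that are thin at all small scales\<close>

text \<open>The centres stay in \<open>E\<close>, so the covering hypothesis applies again to each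
  ball of the previous generation; the counts multiply and the radii shrink by
  \<open>\<eta>\<close>.\<close>

lemma iterated_cover:
  fixes E :: "'a::metric_space set"
  assumes cov: "\<And>x r. x \<in> E \<Longrightarrow> 0 < r \<Longrightarrow> r \<le> r0 \<Longrightarrow>
      \<exists>F. finite F \<and> F \<subseteq> E \<and> card F \<le> M \<and> E \<inter> cball x r \<subseteq> (\<Union>y\<in>F. cball y (\<eta> * r))"
    and "0 < \<eta>" "\<eta> \<le> 1" "0 < r0" "x \<in> E"
  shows "\<exists>F. finite F \<and> F \<subseteq> E \<and> card F \<le> M ^ k \<and>
    E \<inter> cball x r0 \<subseteq> (\<Union>y\<in>F. cball y (\<eta> ^ k * r0))"
proof (induction k)
  case 0
  then show ?case using \<open>x \<in> E\<close> by (intro exI[of _ "{x}"]) auto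
next
  case (Suc k)
  then obtain F where F: "finite F" "F \<subseteq> E" "card F \<le> M ^ k"
    "E \<inter> cball x r0 \<subseteq> (\<Union>y\<in>F. cball y (\<eta> ^ k * r0))" by blast
  have "\<eta> ^ k * r0 \<le> r0"
    using assms(2-4) by (simp add: mult_le_cancel_right1 power_le_one)
  then have "\<exists>G. finite G \<and> G \<subseteq> E \<and> card G \<le> M \<and>
      E \<inter> cball y (\<eta> ^ k * r0) \<subseteq> (\<Union>z\<in>G. cball z (\<eta> * (\<eta> ^ k * r0)))" if "y \<in> F" for y
    using that F(2) assms(2-4) by (intro cov) auto
  then obtain G where G: "\<And>y. y \<in> F \<Longrightarrow> finite (G y) \<and> G y \<subseteq> E \<and> card (G y) \<le> M \<and>
      E \<inter> cball y (\<eta> ^ k * r0) \<subseteq> (\<Union>z\<in>G y. cball z (\<eta> * (\<eta> ^ k * r0)))"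
    by metis
  have "card (\<Union>y\<in>F. G y) \<le> (\<Sum>y\<in>F. card (G y))"
    using F(1) by (rule card_UN_le)
  also have "\<dots> \<le> card F * M"
    using G by (intro sum_bounded_above[where 'a = nat, simplified]) auto
  also have "\<dots> \<le> M ^ Suc k"
    using F(3) by simp
  finally have "card (\<Union>y\<in>F. G y) \<le> M ^ Suc k" .
  moreover have "E \<inter> cball x r0 \<subseteq> (\<Union>z\<in>(\<Union>y\<in>F. G y). cball z (\<eta> ^ Suc k * r0))"
  proof
    fix w assume w: "w \<in> E \<inter> cball x r0"
    then obtain y where y: "y \<in> F" "w \<in> cball y (\<eta> ^ k * r0)" using F(4) by blast
    with w G[of y] obtain z where "z \<in> G y" "w \<in> cball z (\<eta> * (\<eta> ^ k * r0))" by blast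
    with y show "w \<in> (\<Union>z\<in>(\<Union>y\<in>F. G y). cball z (\<eta> ^ Suc k * r0))"
      by (auto simp: mult.assoc)
  qed
  ultimately show ?case
    using F(1) G by (intro exI[of _ "\<Union>y\<in>F. G y"]) blast
qed

text \<open>Sorts a radius into a geometric band. The least power with
  \<open>\<eta> ^ l * r0 < \<rho>\<close> has index above \<open>k0\<close>, hence a predecessor,
  and that predecessor is \<open>k\<close>.\<close>

lemma packing_scale:
  fixes \<rho> :: real
  assumes "0 < \<rho>" "\<rho> \<le> \<eta> ^ k0 * r0" "0 < \<eta>" "\<eta> < 1" "0 < r0"
  obtains k where "k0 \<le> k" "\<eta> ^ Suc k * r0 < \<rho>" "\<rho> \<le> \<eta> ^ k * r0"
proof -
  have "0 < \<rho> / r0" using assms by simp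
  then obtain n where n: "\<eta> ^ n < \<rho> / r0"
    using real_arch_pow_inv assms(4) by blast
  have ex: "\<exists>n. \<eta> ^ n * r0 < \<rho>"
    using n assms(5) by (auto simp: field_simps)
  define l where "l = (LEAST n. \<eta> ^ n * r0 < \<rho>)"
  have l: "\<eta> ^ l * r0 < \<rho>" using ex unfolding l_def by (rule LeastI_ex)
  have min: "\<rho> \<le> \<eta> ^ n * r0" if "n < l" for n
    using not_less_Least that unfolding l_def by (metis not_le)
  have "k0 < l"
  proof (rule ccontr)
    assume "\<not> k0 < l"
    then have "\<eta> ^ k0 * r0 \<le> \<eta> ^ l * r0"
      using assms by (intro mult_right_mono power_decreasing) auto
    then show False using l assms(2) by linarith
  qed
  then obtain k where k: "l = Suc k" by (cases l) auto
  show thesis using that[of k] k \<open>k0 < l\<close> l min[of k] by auto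
qed

text \<open>A packing ball with radius in band \<open>k\<close> contains a centre of the cover of
  generation \<open>Suc k\<close>, and disjoint balls contain different centres. So band
  \<open>k\<close> holds at most \<open>M ^ Suc k\<close> balls, and the sum is dominated by a
  geometric series of ratio \<open>M * \<eta> powr s\<close> starting at \<open>k0\<close>.\<close>

lemma packing_sum_le_geometric:
  fixes E :: "'a::euclidean_space set"
  assumes F: "\<And>k. finite (F k)" "\<And>k. card (F k) \<le> M ^ k" "\<And>k. E \<subseteq> (\<Union>y\<in>F k. cball y (\<eta> ^ k * r0))"
    and \<eta>: "0 < \<eta>" "\<eta> < 1" and r0: "0 < r0" and s: "0 < s"
    and q: "real M * \<eta> powr s < 1"
    and p: "(I, c, \<rho>) \<in> packings E (\<eta> ^ k0 * r0)"
  shows "packing_sum s I \<rho> \<le>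
    ennreal (real M * (2 * r0) powr s * ((real M * \<eta> powr s) ^ k0 / (1 - real M * \<eta> powr s)))"
proof -
  define q where "q = real M * \<eta> powr s"
  have q0: "0 \<le> q" "q < 1" using q by (auto simp: q_def)
  have pI: "c i \<in> E" "0 < \<rho> i" "\<rho> i \<le> \<eta> ^ k0 * r0" if "i \<in> I" for i
    using p that by (auto simp: packings_def)
  have disj: "cball (c i) (\<rho> i) \<inter> cball (c j) (\<rho> j) = {}" if "i \<in> I" "j \<in> I" "i \<noteq> j" for i j
    using p that by (auto simp: packings_def)
  have "\<exists>k. k0 \<le> k \<and> \<eta> ^ Suc k * r0 < \<rho> i \<and> \<rho> i \<le> \<eta> ^ k * r0" if "i \<in> I" for i
    using packing_scale[OF pI(2,3)[OF that] \<eta> r0] by metis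
  then obtain \<kappa> where \<kappa>: "\<And>i. i \<in> I \<Longrightarrow> k0 \<le> \<kappa> i \<and> \<eta> ^ Suc (\<kappa> i) * r0 < \<rho> i \<and> \<rho> i \<le> \<eta> ^ \<kappa> i * r0"
    by metis
  have count: "finite {i \<in> I. \<kappa> i = k} \<and> card {i \<in> I. \<kappa> i = k} \<le> M ^ Suc k" for k
  proof -
    have "\<exists>y. y \<in> F (Suc k) \<and> c i \<in> cball y (\<eta> ^ Suc k * r0)" if "i \<in> I" for i
      using F(3)[of "Suc k"] pI(1)[OF that] by blast
    then obtain h where h: "\<And>i. i \<in> I \<Longrightarrow> h i \<in> F (Suc k) \<and> c i \<in> cball (h i) (\<eta> ^ Suc k * r0)"
      by metis
    \<comment> \<open>The lower end of the band is the covering radius of generation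
      \<open>Suc k\<close>, so \<open>\<rho> i\<close> exceeds the distance from \<open>c i\<close>
      to \<open>h i\<close>.\<close>
    have hin: "h i \<in> cball (c i) (\<rho> i)" if "i \<in> I" "\<kappa> i = k" for i
      using h[of i] \<kappa>[of i] that by (auto simp: dist_commute)
    have "inj_on h {i \<in> I. \<kappa> i = k}"
      using hin disj by (intro inj_onI) (smt (verit) IntI empty_iff mem_Collect_eq)
    moreover have "h ` {i \<in> I. \<kappa> i = k} \<subseteq> F (Suc k)" using h by auto
    ultimately show ?thesis
      using F(1,2)[of "Suc k"] by (meson card_inj_on_le finite_subset inj_on_finite le_trans)
  qed
  \<comment> \<open>\<open>I\<close> may be infinite; a bound uniform over finite subfamilies passes
    to the supremum of the partial sums.\<close>
  have finbound: "(\<Sum>i\<in>J. (2 * \<rho> i) powr s) \<le> real M * (2 * r0) powr s * (q ^ k0 / (1 - q))"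
    if J: "finite J" "J \<subseteq> I" for J
  proof -
    \<comment> \<open>Inserting \<open>k0\<close> keeps the maximum defined for empty
      \<open>J\<close> and guarantees \<open>k0 \<le> n\<close>.\<close>
    define n where "n = Suc (Max (insert k0 (\<kappa> ` J)))"
    have n: "\<kappa> i < n" if "i \<in> J" for i
      using that J by (simp add: n_def less_Suc_eq_le)
    have "(\<Sum>i\<in>J. (2 * \<rho> i) powr s) = (\<Sum>k\<in>{k0..<n}. \<Sum>i\<in>{i \<in> J. \<kappa> i = k}. (2 * \<rho> i) powr s)"
      using J n \<kappa> by (intro sum.group[symmetric]) (auto simp: subset_iff)
    also have "\<dots> \<le> (\<Sum>k\<in>{k0..<n}. real M * (2 * r0) powr s * q ^ k)"
    proof (rule sum_mono)
      fix k
      have "(\<Sum>i\<in>{i \<in> J. \<kappa> i = k}. (2 * \<rho> i) powr s)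
          \<le> real (card {i \<in> J. \<kappa> i = k}) * (2 * (\<eta> ^ k * r0)) powr s"
      proof (rule sum_bounded_above)
        fix i assume "i \<in> {i \<in> J. \<kappa> i = k}"
        then have "i \<in> I" "\<kappa> i = k" using J by auto
        then show "(2 * \<rho> i) powr s \<le> (2 * (\<eta> ^ k * r0)) powr s"
          using \<kappa>[of i] pI(2)[of i] s by (intro powr_mono2) auto
      qed
      also have "card {i \<in> J. \<kappa> i = k} \<le> card {i \<in> I. \<kappa> i = k}"
        using count J by (intro card_mono) auto
      then have "real (card {i \<in> J. \<kappa> i = k}) * (2 * (\<eta> ^ k * r0)) powr s
          \<le> real (M ^ Suc k) * (2 * (\<eta> ^ k * r0)) powr s"
        using count[of k] by (intro mult_right_mono) (auto simp del: power_Suc simp flip: of_nat_power)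
      also have "(2 * (\<eta> ^ k * r0)) powr s = (2 * r0) powr s * (\<eta> powr s) ^ k"
        using \<eta> r0 by (simp add: powr_mult powr_power mult_ac) (simp add: powr_powr mult.commute flip: powr_realpow)
      also have "real (M ^ Suc k) * ((2 * r0) powr s * (\<eta> powr s) ^ k) = real M * (2 * r0) powr s * q ^ k"
        by (simp add: q_def power_mult_distrib)
      finally show "(\<Sum>i\<in>{i \<in> J. \<kappa> i = k}. (2 * \<rho> i) powr s) \<le> real M * (2 * r0) powr s * q ^ k"
        by simp
    qed
    also have "\<dots> = real M * (2 * r0) powr s * (\<Sum>k\<in>{k0..<n}. q ^ k)"
      by (simp add: sum_distrib_left)
    also have "(\<Sum>k\<in>{k0..<n}. q ^ k) \<le> q ^ k0 / (1 - q)"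
    proof -
      have "k0 \<le> n" using J by (simp add: n_def le_SucI)
      then have "(1 - q) * (\<Sum>k\<in>{k0..<n}. q ^ k) = q ^ k0 - q ^ n"
        by (induction rule: dec_induct) (simp_all add: distrib_left left_diff_distrib[where c = "q ^ j" for j])
      then have "(\<Sum>k\<in>{k0..<n}. q ^ k) = (q ^ k0 - q ^ n) / (1 - q)"
        using q0 by (simp add: eq_divide_eq mult.commute)
      also have "\<dots> \<le> q ^ k0 / (1 - q)"
        using q0 by (intro divide_right_mono) auto
      finally show ?thesis .
    qed
    finally show ?thesis
      by (simp add: mult_left_mono)
  qed
  have "packing_sum s I \<rho> \<le> ennreal (real M * (2 * r0) powr s * (q ^ k0 / (1 - q)))"
    unfolding packing_sum_def suminf_eq_SUP
  proof (rule SUP_least)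
    fix n
    have "(\<Sum>i<n. if i \<in> I then ennreal ((2 * \<rho> i) powr s) else 0)
        = (\<Sum>i\<in>{..<n} \<inter> I. ennreal ((2 * \<rho> i) powr s))"
      by (rule sum.inter_restrict[symmetric]) simp
    also have "\<dots> = ennreal (\<Sum>i\<in>{..<n} \<inter> I. (2 * \<rho> i) powr s)"
      by (rule sum_ennreal) auto
    also have "\<dots> \<le> ennreal (real M * (2 * r0) powr s * (q ^ k0 / (1 - q)))"
      by (intro ennreal_leI finbound) auto
    finally show "(\<Sum>i<n. if i \<in> I then ennreal ((2 * \<rho> i) powr s) else 0)
      \<le> ennreal (real M * (2 * r0) powr s * (q ^ k0 / (1 - q)))" .
  qed
  then show ?thesis by (simp add: q_def)
qed

text \<open>With radii at most \<open>\<eta> ^ k * r0\<close>, packing sums are bounded by the tail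
  of a convergent geometric series. As \<open>k\<close> grows this kills the premeasure on each
  \<open>E \<inter> cball x r0\<close>, and countably many such pieces cover
  \<open>E\<close>.\<close>

lemma packing_measure_thin_null:
  fixes E :: "'a::euclidean_space set"
  assumes cov: "\<And>x r. x \<in> E \<Longrightarrow> 0 < r \<Longrightarrow> r \<le> r0 \<Longrightarrow>
      \<exists>F. finite F \<and> F \<subseteq> E \<and> card F \<le> M \<and> E \<inter> cball x r \<subseteq> (\<Union>y\<in>F. cball y (\<eta> * r))"
    and \<eta>: "0 < \<eta>" "\<eta> < 1" and r0: "0 < r0" and s: "0 < s"
    and q: "real M * \<eta> powr s < 1"
  shows "packing_measure s E = 0"
proof -
  have null: "packing_premeasure s (E \<inter> cball x r0) = 0" if "x \<in> E" for x
  proof -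
    define q where "q = real M * \<eta> powr s"
    have "\<exists>F. finite F \<and> F \<subseteq> E \<and> card F \<le> M ^ k \<and>
        E \<inter> cball x r0 \<subseteq> (\<Union>y\<in>F. cball y (\<eta> ^ k * r0))" for k
      using \<eta> r0 that cov by (intro iterated_cover) auto
    then obtain F where F: "\<And>k. finite (F k)" "\<And>k. card (F k) \<le> M ^ k"
      "\<And>k. E \<inter> cball x r0 \<subseteq> (\<Union>y\<in>F k. cball y (\<eta> ^ k * r0))"
      by metis
    have le: "packing_premeasure s (E \<inter> cball x r0)
        \<le> ennreal (real M * (2 * r0) powr s * (q ^ k / (1 - q)))" for k
      unfolding packing_premeasure_def q_def
    proof (rule INF_lower2)
      show "\<eta> ^ k * r0 \<in> {0<..}" using \<eta> r0 by simp
      show "(SUP p\<in>packings (E \<inter> cball x r0) (\<eta> ^ k * r0). packing_sum s (fst p) (snd (snd p)))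
        \<le> ennreal (real M * (2 * r0) powr s * ((real M * \<eta> powr s) ^ k / (1 - real M * \<eta> powr s)))"
        using packing_sum_le_geometric[OF F \<eta> r0 s q] by (intro SUP_least) auto
    qed
    have "(\<lambda>k. real M * (2 * r0) powr s * (q ^ k / (1 - q))) \<longlonglongrightarrow> real M * (2 * r0) powr s * (0 / (1 - q))"
      using q by (intro tendsto_intros LIMSEQ_power_zero) (auto simp: q_def)
    then have "(\<lambda>k. ennreal (real M * (2 * r0) powr s * (q ^ k / (1 - q)))) \<longlonglongrightarrow> ennreal 0"
      by (intro tendsto_ennrealI) simp
    then have "packing_premeasure s (E \<inter> cball x r0) \<le> ennreal 0"
      using le by (intro LIMSEQ_le_const) auto
    then show ?thesis by simp
  qed
  \<comment> \<open>With the constant radius \<open>r0 / 5\<close>, the covering lemma extracts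
    countably many centres whose balls of radius \<open>r0\<close> cover \<open>E\<close>.\<close>
  obtain C where C: "countable C" "C \<subseteq> E" "E \<subseteq> (\<Union>x\<in>C. cball x (5 * (r0 / 5)))"
    by (rule Vitali_covering_lemma_cballs[where S = E and K = E and a = "\<lambda>x. x" and r = "\<lambda>_. r0 / 5" and B = r0]) (use r0 in auto)
  show ?thesis
  proof (cases "C = {}")
    case True
    with C show ?thesis by simp
  next
    case False
    have "E \<subseteq> (\<Union>i. E \<inter> cball (from_nat_into C i) r0)"
      using C(3) UN_from_nat_into[OF C(1) False, of "\<lambda>x. cball x r0"] by auto
    then have "packing_measure s E \<le> (\<Sum>i. packing_premeasure s (E \<inter> cball (from_nat_into C i) r0))"
      by (rule packing_measure_le_suminf)
    also have "\<dots> = 0"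
      using null from_nat_into[OF False] C(2) by (simp add: subset_iff)
    finally show ?thesis by simp
  qed
qed

section \<open>Finitely many classes of directions, subspaces and strips\<close>

text \<open>Reduces the comparison of distance functions to unit vectors. Scaling a nearest point
  gives one inequality; scaling back by \<open>inverse c\<close> gives the other.\<close>

lemma infdist_subspace_scale:
  fixes V :: "'a::euclidean_space set"
  assumes V: "subspace V"
  shows "infdist (c *\<^sub>R x) V = \<bar>c\<bar> * infdist x V"
proof -
  have le: "infdist (c *\<^sub>R x) V \<le> \<bar>c\<bar> * infdist x V" for c x
  proof -
    obtain v where v: "v \<in> V" "infdist x V = dist x v"
      using infdist_attains_inf[of V x] closed_subspace[OF V] subspace_0[OF V] by blast
    have "infdist (c *\<^sub>R x) V \<le> dist (c *\<^sub>R x) (c *\<^sub>R v)"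
      using v V by (intro infdist_le) (auto simp: subspace_scale)
    also have "\<dots> = \<bar>c\<bar> * infdist x V"
      by (simp add: v dist_norm flip: scaleR_diff_right)
    finally show ?thesis .
  qed
  show ?thesis
  proof (cases "c = 0")
    case True
    then show ?thesis using subspace_0[OF V] by simp
  next
    case False
    have "\<bar>c\<bar> * infdist (inverse c *\<^sub>R c *\<^sub>R x) V \<le> \<bar>c\<bar> * (\<bar>inverse c\<bar> * infdist (c *\<^sub>R x) V)"
      by (intro mult_left_mono le) auto
    then have "\<bar>c\<bar> * infdist x V \<le> infdist (c *\<^sub>R x) V"
      using False by (simp add: field_simps)
    with le[of c x] show ?thesis by simp
  qed
qed

lemma sphere_finite_net:
  assumes "0 < \<epsilon>"
  obtains T where "finite T" "T \<subseteq> sphere (0::'a::euclidean_space) 1"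
    "\<And>u. norm u = 1 \<Longrightarrow> \<exists>t\<in>T. dist t u < \<epsilon>"
proof -
  have "compact (sphere (0::'a) 1)" by simp
  then obtain T where "T \<subseteq> sphere (0::'a) 1" "finite T" "sphere (0::'a) 1 \<subseteq> (\<Union>x\<in>T. ball x \<epsilon>)"
    by (rule compactE_image[of "sphere 0 1" "sphere 0 1" "\<lambda>x. ball x \<epsilon>"]) (use assms in auto)
  then show thesis
    by (intro that[of T]) (use UN_iff subsetD in fastforce)+
qed

text \<open>\<open>h\<close> picks a net point within half the tolerance; its fibres serve as the
  direction classes.\<close>

lemma direction_classes:
  assumes "0 < \<epsilon>"
  obtains h :: "'a::euclidean_space \<Rightarrow> 'a" where "finite (h ` sphere 0 1)"
    "\<And>\<theta> \<theta>'. norm \<theta> = 1 \<Longrightarrow> norm \<theta>' = 1 \<Longrightarrow> h \<theta> = h \<theta>' \<Longrightarrow> dist \<theta> \<theta>' \<le> \<epsilon>"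
proof -
  obtain T where T: "finite T" "\<And>u::'a. norm u = 1 \<Longrightarrow> \<exists>t\<in>T. dist t u < \<epsilon> / 2"
    using sphere_finite_net[of "\<epsilon> / 2"] assms by (metis half_gt_zero)
  then obtain h where h: "\<And>u::'a. norm u = 1 \<Longrightarrow> h u \<in> T \<and> dist (h u) u < \<epsilon> / 2"
    by metis
  show thesis
  proof (rule that[of h])
    show "finite (h ` sphere 0 1)"
      using h T(1) by (auto intro: finite_subset[of _ T])
    show "dist \<theta> \<theta>' \<le> \<epsilon>" if "norm \<theta> = 1" "norm \<theta>' = 1" "h \<theta> = h \<theta>'" for \<theta> \<theta>'
      using h[OF that(1)] h[OF that(2)] that(3) dist_triangle_half_r[of "h \<theta>" \<theta> \<epsilon> \<theta>']
      by auto
  qed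
qed

text \<open>A subspace is recorded by the rounded values of its distance function on a finite net of the
  sphere; this makes a topology on the Grassmannian unnecessary.\<close>
lemma subspace_classes:
  assumes "0 < \<epsilon>"
  obtains g :: "'a::euclidean_space set \<Rightarrow> 'a \<Rightarrow> int" where "finite (g ` Collect subspace)"
    "\<And>V W u. subspace V \<Longrightarrow> subspace W \<Longrightarrow> g V = g W \<Longrightarrow> infdist u V \<le> infdist u W + \<epsilon> * norm u"
proof -
  \<comment> \<open>One third of the error is for rounding, and one for each of the two passages
    between \<open>v\<close> and its net point \<open>t\<close>.\<close>
  define e where "e = \<epsilon> / 3"
  have e: "0 < e" using assms by (simp add: e_def)
  obtain T where T: "finite T" "T \<subseteq> sphere (0::'a) 1" "\<And>u::'a. norm u = 1 \<Longrightarrow> \<exists>t\<in>T. dist t u < e"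
    using sphere_finite_net[OF e] by metis
  \<comment> \<open>Restriction to \<open>T\<close> places \<open>g V\<close> in a finite space of
    extensional functions.\<close>
  define g where "g V = restrict (\<lambda>t. \<lfloor>infdist t V / e\<rfloor>) T" for V :: "'a set"
  show thesis
  proof (rule that[of g])
    have "g V \<in> T \<rightarrow>\<^sub>E {0..\<lfloor>1 / e\<rfloor>}" if V: "subspace V" for V
    proof -
      have "infdist t V \<le> 1" if "t \<in> T" for t
        using infdist_le[OF subspace_0[OF V], of t] that T(2) by (auto simp: dist_norm)
      then show ?thesis
        using e by (auto simp: g_def infdist_nonneg intro!: floor_mono divide_right_mono)
    qed
    then have "g ` Collect subspace \<subseteq> T \<rightarrow>\<^sub>E {0..\<lfloor>1 / e\<rfloor>}"
      by (intro image_subsetI) simp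
    then show "finite (g ` Collect subspace)"
      using T(1) by (rule finite_subset[OF _ finite_PiE]) simp
    show "infdist u V \<le> infdist u W + \<epsilon> * norm u"
      if VW: "subspace V" "subspace W" and eq: "g V = g W" for V W u
    proof (cases "u = 0")
      case True
      then show ?thesis using VW by (simp add: subspace_0)
    next
      case False
      define v where "v = u /\<^sub>R norm u"
      have v: "norm v = 1" "u = norm u *\<^sub>R v" using False by (auto simp: v_def)
      obtain t where t: "t \<in> T" "dist t v < e" using T(3)[OF v(1)] by blast
      have "\<lfloor>infdist t V / e\<rfloor> = \<lfloor>infdist t W / e\<rfloor>"
        using fun_cong[OF eq, of t] t by (simp add: g_def)
      then have "infdist t V / e < infdist t W / e + 1"
        by linarith
      then have "infdist t V < infdist t W + e"
        using e by (simp add: field_simps)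
      moreover have "infdist v V \<le> infdist t V + dist v t" "infdist t W \<le> infdist v W + dist t v"
        by (rule infdist_triangle)+
      ultimately have "infdist v V \<le> infdist v W + \<epsilon>"
        using t(2) by (simp add: e_def dist_commute)
      then have "norm u * infdist v V \<le> norm u * (infdist v W + \<epsilon>)"
        by (intro mult_left_mono) auto
      moreover have "infdist u V = norm u * infdist v V" "infdist u W = norm u * infdist v W"
        using v(2) infdist_subspace_scale VW by (metis abs_norm_cancel)+
      ultimately show ?thesis by (simp add: algebra_simps)
    qed
  qed
qed

text \<open>\<open>B\<close> is an orthonormal basis of the orthogonal complement of
  \<open>V\<close>, and the distance to \<open>V\<close> is at most the l1 norm of the coordinates
  in \<open>B\<close>. Rounding these coordinates therefore produces strips.\<close>

lemma infdist_le_sum_orthonormal_complement: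
  fixes V :: "'a::euclidean_space set"
  assumes V: "subspace V"
  obtains B where "finite B" "card B + dim V = DIM('a)" "\<And>b. b \<in> B \<Longrightarrow> norm b = 1"
    "\<And>u. infdist u V \<le> (\<Sum>b\<in>B. \<bar>u \<bullet> b\<bar>)"
proof -
  define W where "W = {y. \<forall>x\<in>V. orthogonal x y}"
  have W: "subspace W" unfolding W_def by (rule subspace_orthogonal_to_vectors)
  have dimW: "dim W + dim V = DIM('a)"
    using dim_subspace_orthogonal_to_vectors[OF V subspace_UNIV] by (simp add: W_def)
  obtain B where B: "B \<subseteq> W" "pairwise orthogonal B" "\<And>x. x \<in> B \<Longrightarrow> norm x = 1"
    "independent B" "card B = dim W" "span B = W"
    using orthonormal_basis_subspace[OF W] by metis
  have finB: "finite B" using B(4) by (rule independent_imp_finite)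
  have "infdist u V \<le> (\<Sum>b\<in>B. \<bar>u \<bullet> b\<bar>)" for u
  proof -
    obtain v w where vw: "v \<in> span V" "\<And>x. x \<in> span V \<Longrightarrow> orthogonal w x" "u = v + w"
      using orthogonal_subspace_decomp_exists[of V u] by metis
    have vV: "v \<in> V" using vw(1) V by (metis span_eq_iff)
    have "w \<in> W" using vw(2) by (auto simp: W_def orthogonal_commute span_base)
    then have "w \<in> span B" using B by simp
    then have weq: "(\<Sum>b\<in>B. (w \<bullet> b) *\<^sub>R b) = w"
      using B finB by (subst orthonormal_basis_expand) auto
    have vb: "v \<bullet> b = 0" if "b \<in> B" for b
      using that B(1) vV by (auto simp: W_def orthogonal_def)
    have "infdist u V \<le> dist u v" using vV by (rule infdist_le)
    also have "\<dots> = norm (\<Sum>b\<in>B. (w \<bullet> b) *\<^sub>R b)" by (simp add: vw(3) dist_norm weq)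
    also have "\<dots> \<le> (\<Sum>b\<in>B. norm ((w \<bullet> b) *\<^sub>R b))" by (rule norm_sum)
    also have "\<dots> = (\<Sum>b\<in>B. \<bar>u \<bullet> b\<bar>)"
      using B(3) vb by (intro sum.cong) (auto simp: vw(3) inner_add_left)
    finally show ?thesis .
  qed
  then show thesis using that[of B] finB dimW B by simp
qed

text \<open>The \<open>m\<close> coordinates orthogonal to \<open>V\<close> are rounded to multiples
  of \<open>r / real N\<close>. Each takes at most \<open>2 * N + 1 \<le> 3 * N\<close> values on
  the ball, and points of one cell differ by at most \<open>r / real N\<close> in each
  coordinate.\<close>

lemma strip_classes:
  fixes V :: "'a::euclidean_space set" and x :: 'a
  assumes V: "subspace V" "dim V + m = DIM('a)" and N: "0 < N" and r: "0 < r"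
  obtains f :: "'a \<Rightarrow> 'a \<Rightarrow> int" where "finite (f ` cball x r)" "card (f ` cball x r) \<le> (3 * N) ^ m"
    "\<And>y z. f y = f z \<Longrightarrow> infdist (y - z) V \<le> real m * (r / real N)"
proof -
  obtain B where B: "finite B" "card B + dim V = DIM('a)" "\<And>b. b \<in> B \<Longrightarrow> norm b = 1"
    "\<And>u. infdist u V \<le> (\<Sum>b\<in>B. \<bar>u \<bullet> b\<bar>)"
    using infdist_le_sum_orthonormal_complement[OF V(1)] by metis
  have cardB: "card B = m" using B V by simp
  define f where "f y = restrict (\<lambda>b. \<lfloor>real N * ((y - x) \<bullet> b) / r\<rfloor>) B" for y
  have sub: "f ` cball x r \<subseteq> B \<rightarrow>\<^sub>E {- int N..int N}"
  proof -
    have "\<lfloor>real N * ((y - x) \<bullet> b) / r\<rfloor> \<in> {- int N..int N}" if "y \<in> cball x r" "b \<in> B" for y b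
    proof -
      have "\<bar>(y - x) \<bullet> b\<bar> \<le> norm (y - x) * norm b" by (rule Cauchy_Schwarz_ineq2)
      also have "\<dots> \<le> r" using that B(3) by (simp add: dist_norm norm_minus_commute)
      finally have "- 1 \<le> ((y - x) \<bullet> b) / r" "((y - x) \<bullet> b) / r \<le> 1"
        using r by (auto simp: field_simps)
      then have "real N * (- 1) \<le> real N * (((y - x) \<bullet> b) / r)" "real N * (((y - x) \<bullet> b) / r) \<le> real N * 1"
        by (intro mult_left_mono; simp)+
      then show ?thesis by (simp add: le_floor_iff floor_le_iff)
    qed
    then show ?thesis by (auto simp: f_def)
  qed
  have fin: "finite (B \<rightarrow>\<^sub>E {- int N..int N})" using B(1) by (intro finite_PiE) auto
  show thesis
  proof (rule that[of f])
    show "finite (f ` cball x r)" using sub fin by (rule finite_subset)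
    have "card (f ` cball x r) \<le> card (B \<rightarrow>\<^sub>E {- int N..int N})"
      using sub fin by (intro card_mono)
    also have "\<dots> = (2 * N + 1) ^ m"
      using B(1) cardB by (simp add: card_PiE nat_add_distrib nat_mult_distrib)
    also have "\<dots> \<le> (3 * N) ^ m"
      using N by (intro power_mono) auto
    finally show "card (f ` cball x r) \<le> (3 * N) ^ m" .
    show "infdist (y - z) V \<le> real m * (r / real N)" if eq: "f y = f z" for y z
    proof -
      have "\<bar>(y - z) \<bullet> b\<bar> \<le> r / real N" if "b \<in> B" for b
      proof -
        have "\<lfloor>real N * ((y - x) \<bullet> b) / r\<rfloor> = \<lfloor>real N * ((z - x) \<bullet> b) / r\<rfloor>"
          using fun_cong[OF eq, of b] that by (simp add: f_def)
        then have "\<bar>real N * ((y - x) \<bullet> b) / r - real N * ((z - x) \<bullet> b) / r\<bar> \<le> 1"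
          by linarith
        also have "real N * ((y - x) \<bullet> b) / r - real N * ((z - x) \<bullet> b) / r = ((y - z) \<bullet> b) * (real N / r)"
          by (simp add: algebra_simps diff_divide_distrib)
        finally show ?thesis using N r by (simp add: abs_mult field_simps)
      qed
      then have "(\<Sum>b\<in>B. \<bar>(y - z) \<bullet> b\<bar>) \<le> (\<Sum>b\<in>B. r / real N)"
        by (intro sum_mono)
      then show ?thesis using B(4)[of "y - z"] cardB by simp
    qed
  qed
qed

text \<open>One representative per class; choosing it in \<open>S\<close> keeps the centres in the
  set, as the iteration of covers requires.\<close>

lemma finite_cover_of_classes:
  assumes "finite (f ` S)" "card (f ` S) \<le> M"
    and "\<And>y z. y \<in> S \<Longrightarrow> z \<in> S \<Longrightarrow> f y = f z \<Longrightarrow> dist y z \<le> \<rho>"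
  shows "\<exists>F. finite F \<and> F \<subseteq> S \<and> card F \<le> M \<and> S \<subseteq> (\<Union>y\<in>F. cball y \<rho>)"
proof (intro exI conjI)
  let ?F = "inv_into S f ` (f ` S)"
  show "finite ?F" using assms(1) by blast
  show "?F \<subseteq> S" by (auto intro: inv_into_into)
  show "card ?F \<le> M" using card_image_le[OF assms(1)] assms(2) le_trans by blast
  show "S \<subseteq> (\<Union>y\<in>?F. cball y \<rho>)"
  proof
    fix z assume z: "z \<in> S"
    then have "dist (inv_into S f (f z)) z \<le> \<rho>"
      by (intro assms(3)) (auto intro: inv_into_into f_inv_into_f)
    with z show "z \<in> (\<Union>y\<in>?F. cball y \<rho>)" by auto
  qed
qed

section \<open>Conical densities\<close>

text \<open>With \<open>d = dist y z\<close>, moving from \<open>z\<close> to \<open>w\<close> costs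
  less than \<open>\<alpha> / 4 * d\<close>. So \<open>\<alpha> * norm (w - y)\<close> is at least
  \<open>3 * \<alpha> / 4 * d\<close>, while the distance to \<open>V\<close> stays strictly below
  this value and the component along \<open>\<theta>\<close> stays at most
  \<open>\<alpha> / 2 * d\<close>.\<close>

lemma cball_subset_cone:
  fixes y z \<theta> :: "'a::euclidean_space"
  assumes "0 < \<alpha>" "\<alpha> \<le> 1" "norm \<theta> = 1"
    and V: "infdist (z - y) V \<le> \<alpha> / 2 * dist y z"
    and \<theta>: "(z - y) \<bullet> \<theta> \<le> \<alpha> / 4 * dist y z"
    and t: "t < \<alpha> / 4 * dist y z"
  shows "cball z t \<subseteq> Xcone y V \<alpha> - Hcone y \<theta> \<alpha>"
proof
  fix w assume "w \<in> cball z t"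
  then have w: "dist w z < \<alpha> / 4 * dist y z" using t by (simp add: dist_commute)
  have "\<alpha> / 4 * dist y z \<le> 1 / 4 * dist y z"
    using assms by (intro mult_right_mono) auto
  then have "3 / 4 * dist y z \<le> norm (w - y)"
    using w dist_triangle[of y z w] by (simp add: dist_norm norm_minus_commute)
  then have far: "3 * \<alpha> / 4 * dist y z \<le> \<alpha> * norm (w - y)"
    using mult_left_mono[of "3 / 4 * dist y z" "norm (w - y)" \<alpha>] assms(1) by simp
  have "infdist (w - y) V \<le> infdist (z - y) V + dist (w - y) (z - y)" by (rule infdist_triangle)
  then have "infdist (w - y) V < 3 * \<alpha> / 4 * dist y z"
    using V w by (simp add: dist_norm)
  moreover have "(w - z) \<bullet> \<theta> \<le> norm (w - z) * norm \<theta>" by (rule norm_cauchy_schwarz)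
  then have "(w - y) \<bullet> \<theta> \<le> \<alpha> / 2 * dist y z"
    using \<theta> w assms(3) by (simp add: dist_norm inner_diff_left)
  moreover have "\<alpha> / 2 * dist y z \<le> 3 * \<alpha> / 4 * dist y z"
    using assms(1) by (intro mult_right_mono) auto
  ultimately show "w \<in> Xcone y V \<alpha> - Hcone y \<theta> \<alpha>"
    using far by (simp add: Xcone_def Hcone_def)
qed

text \<open>Two distant points of one class in one strip are impossible: the one lying further in the nearly
  common direction \<open>\<theta>\<close> would have the small ball around the other one outside its half-space cone.\<close>
lemma cover_if_cones_thin:
  fixes S :: "'a::euclidean_space set" and \<theta> :: "'a \<Rightarrow> 'a" and V :: "'a \<Rightarrow> 'a set"
  assumes \<alpha>: "0 < \<alpha>" "\<alpha> \<le> 1" and N: "0 < N" and r: "0 < r" and S: "S \<subseteq> cball x r"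
    and VG: "\<And>y. y \<in> S \<Longrightarrow> subspace (V y) \<and> dim (V y) + m = DIM('a)"
    and \<theta>: "\<And>y. y \<in> S \<Longrightarrow> norm (\<theta> y) = 1"
    and h: "finite (h ` sphere (0::'a) 1)"
      "\<And>\<theta> \<theta>'. norm \<theta> = 1 \<Longrightarrow> norm \<theta>' = 1 \<Longrightarrow> h \<theta> = h \<theta>' \<Longrightarrow> dist \<theta> \<theta>' \<le> \<alpha> / 4"
    and g: "finite (g ` Collect (subspace :: 'a set \<Rightarrow> bool))"
      "\<And>V W u. subspace V \<Longrightarrow> subspace W \<Longrightarrow> g V = g W \<Longrightarrow> infdist u V \<le> infdist u W + \<alpha> / 4 * norm u"
    and thin: "\<And>y z. y \<in> S \<Longrightarrow> z \<in> S \<Longrightarrow>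
      \<not> cball z (r / real N) \<subseteq> Xcone_r y (3 * r) (V y) \<alpha> - Hcone y (\<theta> y) \<alpha>"
  shows "\<exists>F. finite F \<and> F \<subseteq> S \<and>
      card F \<le> card (h ` sphere 0 1) * card (g ` Collect subspace) * (3 * N) ^ m \<and>
      S \<subseteq> (\<Union>y\<in>F. cball y (4 * real (m + 1) / \<alpha> * (r / real N)))"
proof -
  define \<G> where "\<G> = {V :: 'a set. subspace V \<and> dim V + m = DIM('a)}"
  \<comment> \<open>Strips are taken around one representative subspace per class, so that points
    with different \<open>V y\<close> share a strip system. Choosing it in \<open>\<G>\<close> fixes
    the number of strips at \<open>(3 * N) ^ m\<close> or fewer.\<close>
  define rep where "rep k = (SOME W. W \<in> \<G> \<and> g W = k)" for k
  have rep: "rep (g W) \<in> \<G> \<and> g (rep (g W)) = g W" if "W \<in> \<G>" for W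
    unfolding rep_def by (rule someI[of _ W]) (use that in simp)
  have "\<exists>f :: 'a \<Rightarrow> 'a \<Rightarrow> int. finite (f ` cball x r) \<and> card (f ` cball x r) \<le> (3 * N) ^ m \<and>
      (\<forall>y z. f y = f z \<longrightarrow> infdist (y - z) W \<le> real m * (r / real N))" if "W \<in> \<G>" for W
    using strip_classes[of W m N r x] that N r by (auto simp: \<G>_def) metis
  then obtain f :: "'a set \<Rightarrow> 'a \<Rightarrow> 'a \<Rightarrow> int" where f: "\<And>W. W \<in> \<G> \<Longrightarrow>
      finite (f W ` cball x r) \<and> card (f W ` cball x r) \<le> (3 * N) ^ m \<and>
      (\<forall>y z. f W y = f W z \<longrightarrow> infdist (y - z) W \<le> real m * (r / real N))"
    by metis
  have VG': "V y \<in> \<G>" if "y \<in> S" for y using VG[OF that] by (simp add: \<G>_def)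
  define key where "key y = ((h (\<theta> y), g (V y)), f (rep (g (V y))) y)" for y
  define K where "K = h ` sphere 0 1 \<times> g ` \<G>"
  \<comment> \<open>The strip index depends on the subspace class, so the possible keys form a
    dependent sum.\<close>
  define L where "L = (SIGMA k:K. f (rep (snd k)) ` cball x r)"
  have subG: "g ` \<G> \<subseteq> g ` Collect subspace" by (auto simp: \<G>_def)
  have finK: "finite K" unfolding K_def using h(1) g(1) subG by (auto intro: finite_subset)
  have cardK: "card K \<le> card (h ` sphere 0 1) * card (g ` Collect subspace)"
    unfolding K_def card_cartesian_product by (intro mult_left_mono card_mono g(1) subG) auto
  have fK: "finite (f (rep (snd k)) ` cball x r)" "card (f (rep (snd k)) ` cball x r) \<le> (3 * N) ^ m"
    if "k \<in> K" for k
    using that f rep by (auto simp: K_def)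
  have finL: "finite L" unfolding L_def using finK fK by (intro finite_SigmaI) auto
  have "card L = (\<Sum>k\<in>K. card (f (rep (snd k)) ` cball x r))"
    unfolding L_def using finK fK by (intro card_SigmaI) auto
  also have "\<dots> \<le> card K * (3 * N) ^ m"
    using sum_bounded_above[of K "\<lambda>k. card (f (rep (snd k)) ` cball x r)" "(3 * N) ^ m"] fK by simp
  also have "\<dots> \<le> card (h ` sphere 0 1) * card (g ` Collect subspace) * (3 * N) ^ m"
    using cardK by (intro mult_right_mono) auto
  finally have cardL: "card L \<le> card (h ` sphere 0 1) * card (g ` Collect subspace) * (3 * N) ^ m" .
  have keyL: "key ` S \<subseteq> L"
    using S VG' \<theta> by (auto simp: key_def L_def K_def)
  show ?thesis
  proof (rule finite_cover_of_classes)
    show "finite (key ` S)" using keyL finL by (rule finite_subset)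
    show "card (key ` S) \<le> card (h ` sphere 0 1) * card (g ` Collect subspace) * (3 * N) ^ m"
      using card_mono[OF finL keyL] cardL by linarith
    fix y z assume yz: "y \<in> S" "z \<in> S" "key y = key z"
    show "dist y z \<le> 4 * real (m + 1) / \<alpha> * (r / real N)"
    proof (rule ccontr)
      assume "\<not> ?thesis"
      \<comment> \<open>The covering radius is tuned so that \<open>\<alpha> / 4 * dist y z\<close>
        exceeds \<open>m + 1\<close> strip widths: \<open>m\<close> for the distance to the
        representative subspace, one for the radius of the small ball.\<close>
      then have "\<alpha> / 4 * (4 * real (m + 1) / \<alpha> * (r / real N)) < \<alpha> / 4 * dist y z"
        using \<alpha> by (intro mult_strict_left_mono) auto
      moreover have "\<alpha> / 4 * (4 * k / \<alpha> * t) = k * t" for k t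
        using \<alpha> by simp
      ultimately have d: "real (m + 1) * (r / real N) < \<alpha> / 4 * dist y z" by metis
      have rN: "0 \<le> r / real N" using r N by simp
      have expand: "real (m + 1) * t = real m * t + t" for t
        by (simp add: distrib_right)
      then have d1: "r / real N < \<alpha> / 4 * dist y z" and dm: "real m * (r / real N) \<le> \<alpha> / 4 * dist y z"
        using d mult_nonneg_nonneg[OF of_nat_0_le_iff[of m] rN] expand[of "r / real N"] rN by linarith+
      have yz_in: "dist x y \<le> r" "dist x z \<le> r" using yz S by auto
      \<comment> \<open>Stated for a generic pair because either of \<open>y\<close> and
        \<open>z\<close> may have to be the vertex.\<close>
      have cone: False if ab: "a \<in> S" "b \<in> S" "key a = key b" "dist a b = dist y z"
        "(b - a) \<bullet> \<theta> a \<le> \<alpha> / 4 * dist a b" for a b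
      proof -
        let ?W = "rep (g (V a))"
        have nab: "norm (b - a) = dist y z"
          using ab(4) by (simp add: dist_norm norm_minus_commute)
        have W: "?W \<in> \<G>" "g ?W = g (V a)" using rep VG'[OF ab(1)] by auto
        have "f ?W b = f ?W a" using ab(3) unfolding key_def by (metis Pair_inject)
        then have "infdist (b - a) ?W \<le> real m * (r / real N)" using f[OF W(1)] by blast
        moreover have "infdist (b - a) (V a) \<le> infdist (b - a) ?W + \<alpha> / 4 * norm (b - a)"
          using W VG[OF ab(1)] by (intro g(2)) (auto simp: \<G>_def)
        ultimately have "infdist (b - a) (V a) \<le> \<alpha> / 2 * dist a b"
          using dm unfolding ab(4) nab by linarith
        then have "cball b (r / real N) \<subseteq> Xcone a (V a) \<alpha> - Hcone a (\<theta> a) \<alpha>"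
          using \<alpha> \<theta> ab d1 by (intro cball_subset_cone) auto
        \<comment> \<open>Two points of the ball of radius \<open>r\<close> are at most
          \<open>2 * r\<close> apart and the small ball adds at most \<open>r\<close>; hence cones
          of radius \<open>3 * r\<close>.\<close>
        moreover have "cball b (r / real N) \<subseteq> cball a (3 * r)"
        proof
          fix w assume w: "w \<in> cball b (r / real N)"
          have "r / real N \<le> r" using N r by (simp add: field_simps)
          moreover have "dist a b \<le> 2 * r"
            using ab(4) yz_in dist_triangle3[of y z x] by linarith
          ultimately show "w \<in> cball a (3 * r)"
            using w dist_triangle[of a w b] by simp
        qed
        ultimately show False using thin[OF ab(1,2)] by (auto simp: Xcone_r_def)
      qed
      show False
      proof (cases "(z - y) \<bullet> \<theta> y \<le> 0")
        case True
        then have "(z - y) \<bullet> \<theta> y \<le> \<alpha> / 4 * dist y z"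
          by (rule order_trans) (use \<alpha> in simp)
        then show False using cone[of y z] yz by simp
      next
        case False
        have close: "dist (\<theta> z) (\<theta> y) \<le> \<alpha> / 4"
          using yz \<theta> by (intro h(2)) (auto simp: key_def)
        \<comment> \<open>With \<open>z\<close> as vertex, the term with \<open>\<theta> y\<close>
          is negative, and the change of direction costs at most \<open>\<alpha> / 4\<close> times
          the distance.\<close>
        have "(y - z) \<bullet> \<theta> z = (y - z) \<bullet> (\<theta> z - \<theta> y) + (y - z) \<bullet> \<theta> y"
          by (simp add: inner_diff_right)
        also have "\<dots> \<le> norm (y - z) * norm (\<theta> z - \<theta> y) + 0"
          using False by (intro add_mono norm_cauchy_schwarz) (simp add: inner_diff_left)
        also have "\<dots> \<le> norm (y - z) * (\<alpha> / 4)"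
          using mult_left_mono[OF close, of "norm (y - z)"] by (simp add: dist_norm)
        finally show False
          using cone[of z y] yz by (simp add: dist_commute dist_norm norm_minus_commute mult.commute)
      qed
    qed
  qed
qed

text \<open>The product of ball count and scale ratio to the power \<open>s\<close> is a constant
  times \<open>real N powr (real m - s)\<close>, which tends to 0 because
  \<open>m < s\<close>.\<close>

lemma eventually_powr_small:
  fixes s :: real
  assumes "real m < s" "0 < C"
  obtains N where "0 < N" "real (K * (3 * N) ^ m) * (C / real N) powr s < 1" "C / real N < 1"
proof -
  have "(\<lambda>N. real K * 3 ^ m * C powr s * real N powr (real m - s)) \<longlonglongrightarrow> real K * 3 ^ m * C powr s * 0"
    using assms by (intro tendsto_intros tendsto_neg_powr filterlim_real_sequentially) auto
  then have "\<forall>\<^sub>F N in sequentially. real K * 3 ^ m * C powr s * real N powr (real m - s) < 1"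
    by (intro order_tendstoD(2)[where y = "0::real"]) auto
  moreover have "\<forall>\<^sub>F N in sequentially. C < real N"
    using filterlim_real_sequentially by (simp add: filterlim_at_top_dense)
  ultimately have "\<forall>\<^sub>F N in sequentially.
      real K * 3 ^ m * C powr s * real N powr (real m - s) < 1 \<and> C < real N"
    by eventually_elim simp
  then obtain N where N: "real K * 3 ^ m * C powr s * real N powr (real m - s) < 1" "C < real N"
    by (auto simp: eventually_sequentially)
  have N0: "0 < N" using N assms by (intro Nat.gr0I) auto
  have "(C / real N) powr s = C powr s / real N powr s"
    "real N powr (real m - s) = real N ^ m / real N powr s"
    using N0 assms by (simp_all add: powr_divide powr_diff powr_realpow)
  then have eq: "real (K * (3 * N) ^ m) * (C / real N) powr s
      = real K * 3 ^ m * C powr s * real N powr (real m - s)"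
    by (simp add: power_mult_distrib)
  show thesis
  proof (rule that[OF N0])
    show "real (K * (3 * N) ^ m) * (C / real N) powr s < 1" using N(1) by (simp only: eq)
    show "C / real N < 1" using N(2) N0 by simp
  qed
qed

theorem theorem3p1:
  fixes m :: nat and s \<alpha> :: real
  assumes "m < DIM('a::euclidean_space)" and "real m < s" and "s \<le> real DIM('a)"
    and "0 < \<alpha>" and "\<alpha> \<le> 1"
  shows "\<exists>c>0. \<forall>A :: 'a set. packing_measure s A < \<infinity> \<longrightarrow>
    packing_measure s {x \<in> A. \<not> (ennreal c \<le> Limsup (at_right 0) (\<lambda>r.
        INF p\<in>sphere (0::'a) 1 \<times> grassmannian (DIM('a) - m).
          packing_measure s (A \<inter> Xcone_r x r (snd p) \<alpha> - Hcone x (fst p) \<alpha>)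
            / ennreal ((2 * r) powr s)))} = 0"
proof -
  have s: "0 < s" using assms(2) by simp
  have \<alpha>4: "0 < \<alpha> / 4" using assms(4) by simp
  obtain h :: "'a \<Rightarrow> 'a" where h: "finite (h ` sphere 0 1)"
    "\<And>\<theta> \<theta>'. norm \<theta> = 1 \<Longrightarrow> norm \<theta>' = 1 \<Longrightarrow> h \<theta> = h \<theta>' \<Longrightarrow> dist \<theta> \<theta>' \<le> \<alpha> / 4"
    using direction_classes[OF \<alpha>4] by metis
  obtain g :: "'a set \<Rightarrow> 'a \<Rightarrow> int" where g: "finite (g ` Collect subspace)"
    "\<And>V W u. subspace V \<Longrightarrow> subspace W \<Longrightarrow> g V = g W \<Longrightarrow> infdist u V \<le> infdist u W + \<alpha> / 4 * norm u"
    using subspace_classes[OF \<alpha>4] by metis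
  \<comment> \<open>\<open>C / real N\<close> is the ratio of new to old radius in the cover by one
    class per ball.\<close>
  define C where "C = 4 * real (m + 1) / \<alpha>"
  have C: "0 < C" using assms(4) by (simp add: C_def)
  obtain N where N: "0 < N" "C / real N < 1"
    "real (card (h ` sphere 0 1) * card (g ` Collect subspace) * (3 * N) ^ m) * (C / real N) powr s < 1"
    using eventually_powr_small[OF assms(2) C] by metis
  \<comment> \<open>Chosen so that \<open>c * (6 * r) powr s\<close> is exactly the lower density
    bound for a ball of radius \<open>r / real N\<close>. All ingredients are fixed before
    \<open>A\<close>.\<close>
  define c where "c = (1 / (3 * real N)) powr s / (2 * 5 powr s)"
  have c: "0 < c" using N by (simp add: c_def)
  show ?thesis
  proof (intro exI[of _ c] conjI allI impI c)
    fix A :: "'a set" assume fin: "packing_measure s A < \<infinity>"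
    define \<Phi> where "\<Phi> x r = (INF p\<in>sphere (0::'a) 1 \<times> grassmannian (DIM('a) - m).
          packing_measure s (A \<inter> Xcone_r x r (snd p) \<alpha> - Hcone x (fst p) \<alpha>)
            / ennreal ((2 * r) powr s))" for x r
    define D where "D = {x \<in> A. \<not> (\<exists>\<epsilon>>0. \<forall>r. 0 < r \<and> r < \<epsilon> \<longrightarrow>
      ennreal ((2 * r) powr s / (2 * 5 powr s)) \<le> packing_measure s (A \<inter> cball x r))}"
    have D: "packing_measure s D = 0"
      unfolding D_def using fin by (rule packing_measure_lower_density)
    \<comment> \<open>The bad points are sorted by a scale \<open>1 / (n + 1)\<close> below which
      both the thinness of cones and the lower density bound hold.\<close>
    define E where "E n = {x \<in> A. \<forall>r. 0 < r \<and> r < inverse (real (Suc n)) \<longrightarrow> \<Phi> x r < ennreal c \<and>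
      ennreal ((2 * r) powr s / (2 * 5 powr s)) \<le> packing_measure s (A \<inter> cball x r)}" for n
    have E: "packing_measure s (E n) = 0" for n
    \<comment> \<open>The quarter in \<open>r0\<close> keeps \<open>3 * r\<close> below the
      threshold of \<open>E n\<close>.\<close>
    proof (rule packing_measure_thin_null[where ?r0.0 = "inverse (real (Suc n)) / 4" and \<eta> = "C / real N"
          and M = "card (h ` sphere 0 1) * card (g ` Collect subspace) * (3 * N) ^ m"])
      let ?r0 = "inverse (real (Suc n)) / 4"
      show "0 < ?r0" by simp
      show "0 < C / real N" "C / real N < 1" using C N by auto
      show "0 < s" by fact
      show "real (card (h ` sphere 0 1) * card (g ` Collect subspace) * (3 * N) ^ m)
          * (C / real N) powr s < 1" by fact
      fix x r assume xr: "x \<in> E n" "0 < r" "r \<le> ?r0"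
      have small: "3 * r < inverse (real (Suc n))" "0 < r / real N" "r / real N < inverse (real (Suc n))"
      proof -
        have "r < 4 * ?r0" "3 * r < 4 * ?r0" using xr(2,3) by linarith+
        then show "3 * r < inverse (real (Suc n))" by simp
        show "0 < r / real N" using xr N by simp
        have "r / real N \<le> r" using xr N by (simp add: field_simps)
        with \<open>r < 4 * ?r0\<close> show "r / real N < inverse (real (Suc n))" by simp
      qed
      have "\<exists>p. p \<in> sphere (0::'a) 1 \<times> grassmannian (DIM('a) - m) \<and>
          packing_measure s (A \<inter> Xcone_r y (3 * r) (snd p) \<alpha> - Hcone y (fst p) \<alpha>)
            / ennreal ((2 * (3 * r)) powr s) < ennreal c" if "y \<in> E n" for y
      proof -
        have "\<Phi> y (3 * r) < ennreal c" using that small xr by (simp add: E_def)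
        then show ?thesis unfolding \<Phi>_def INF_less_iff by blast
      qed
      \<comment> \<open>Each point gets its own direction and subspace witnessing that the infimum
        is below \<open>c\<close> at radius \<open>3 * r\<close>.\<close>
      then obtain p where p: "\<And>y. y \<in> E n \<Longrightarrow> p y \<in> sphere (0::'a) 1 \<times> grassmannian (DIM('a) - m)"
        "\<And>y. y \<in> E n \<Longrightarrow> packing_measure s (A \<inter> Xcone_r y (3 * r) (snd (p y)) \<alpha> - Hcone y (fst (p y)) \<alpha>)
            / ennreal ((2 * (3 * r)) powr s) < ennreal c"
        by metis
      have "\<exists>F. finite F \<and> F \<subseteq> E n \<inter> cball x r \<and>
        card F \<le> card (h ` sphere 0 1) * card (g ` Collect subspace) * (3 * N) ^ m \<and>
        E n \<inter> cball x r \<subseteq> (\<Union>y\<in>F. cball y (4 * real (m + 1) / \<alpha> * (r / real N)))"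
      proof (rule cover_if_cones_thin[where \<theta> = "fst \<circ> p" and V = "snd \<circ> p"])
        show "subspace ((snd \<circ> p) y) \<and> dim ((snd \<circ> p) y) + m = DIM('a)" if "y \<in> E n \<inter> cball x r" for y
          using p(1)[of y] that assms(1) by (auto simp: grassmannian_def)
        show "norm ((fst \<circ> p) y) = 1" if "y \<in> E n \<inter> cball x r" for y
          using p(1)[of y] that by auto
        fix y z assume yz: "y \<in> E n \<inter> cball x r" "z \<in> E n \<inter> cball x r"
        let ?X = "Xcone_r y (3 * r) ((snd \<circ> p) y) \<alpha>" and ?H = "Hcone y ((fst \<circ> p) y) \<alpha>"
        show "\<not> cball z (r / real N) \<subseteq> ?X - ?H"
        proof
          \<comment> \<open>A cone containing the small ball would inherit its lower density bound,
            which contradicts the choice of \<open>p y\<close>.\<close>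
          assume sub: "cball z (r / real N) \<subseteq> ?X - ?H"
          have "(2 * (r / real N)) powr s = (1 / (3 * real N)) powr s * (2 * (3 * r)) powr s"
            using xr N by (subst powr_mult[symmetric]) auto
          then have "c * (2 * (3 * r)) powr s = (2 * (r / real N)) powr s / (2 * 5 powr s)"
            by (simp add: c_def)
          then have "ennreal c * ennreal ((2 * (3 * r)) powr s)
              = ennreal ((2 * (r / real N)) powr s / (2 * 5 powr s))"
            using c by (subst ennreal_mult[symmetric]) auto
          also have "\<dots> \<le> packing_measure s (A \<inter> cball z (r / real N))"
            using yz(2) small(2,3) unfolding E_def by blast
          also have "\<dots> \<le> packing_measure s (A \<inter> ?X - ?H)"
            using sub by (intro packing_measure_mono) auto
          finally have "ennreal c * ennreal ((2 * (3 * r)) powr s) / ennreal ((2 * (3 * r)) powr s)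
              \<le> packing_measure s (A \<inter> ?X - ?H) / ennreal ((2 * (3 * r)) powr s)"
            by (rule divide_right_mono_ennreal)
          also have "\<dots> < ennreal c" using p(2)[of y] yz by simp
          finally show False
            using xr by (simp add: ennreal_mult_divide_eq)
        qed
      qed (use assms N xr h g in auto)
      then show "\<exists>F. finite F \<and> F \<subseteq> E n \<and>
        card F \<le> card (h ` sphere 0 1) * card (g ` Collect subspace) * (3 * N) ^ m \<and>
        E n \<inter> cball x r \<subseteq> (\<Union>y\<in>F. cball y (C / real N * r))"
        by (simp add: C_def) blast
    qed
    \<comment> \<open>Outside \<open>D\<close>, an upper limit below \<open>c\<close> gives
      \<open>\<Phi> x r < ennreal c\<close> for all small \<open>r\<close>, so \<open>x\<close> lies
      in some \<open>E n\<close>; index 0 is reserved for \<open>D\<close>.\<close>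
    have cover: "{x \<in> A. \<not> (ennreal c \<le> Limsup (at_right 0) (\<Phi> x))}
        \<subseteq> (\<Union>i. case i of 0 \<Rightarrow> D | Suc n \<Rightarrow> E n)"
    proof
      fix x assume x: "x \<in> {x \<in> A. \<not> (ennreal c \<le> Limsup (at_right 0) (\<Phi> x))}"
      show "x \<in> (\<Union>i. case i of 0 \<Rightarrow> D | Suc n \<Rightarrow> E n)"
      proof (cases "x \<in> D")
        case True
        then show ?thesis by (auto intro!: exI[of _ 0])
      next
        case False
        with x obtain \<epsilon> where \<epsilon>: "0 < \<epsilon>" "\<And>r. 0 < r \<Longrightarrow> r < \<epsilon> \<Longrightarrow>
            ennreal ((2 * r) powr s / (2 * 5 powr s)) \<le> packing_measure s (A \<inter> cball x r)"
          by (auto simp: D_def)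
        have "\<forall>\<^sub>F r in at_right 0. \<Phi> x r < ennreal c"
          using x by (intro Limsup_lessD) (auto simp: not_le)
        then obtain b where b: "0 < b" "\<And>r. 0 < r \<Longrightarrow> r < b \<Longrightarrow> \<Phi> x r < ennreal c"
          by (auto simp: eventually_at_right_field)
        obtain n where "inverse (real (Suc n)) < min \<epsilon> b"
          using reals_Archimedean[of "min \<epsilon> b"] \<epsilon> b by auto
        then have "x \<in> E n" using x \<epsilon> b by (auto simp: E_def)
        then show ?thesis by (auto intro!: exI[of _ "Suc n"])
      qed
    qed
    have "packing_measure s (\<Union>i. case i of 0 \<Rightarrow> D | Suc n \<Rightarrow> E n) = 0"
      using D E by (intro packing_measure_UN_null) (simp split: nat.split)
    then have "packing_measure s {x \<in> A. \<not> (ennreal c \<le> Limsup (at_right 0) (\<Phi> x))} = 0"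
      using packing_measure_mono[OF cover, of s] by simp
    then show "packing_measure s {x \<in> A. \<not> (ennreal c \<le> Limsup (at_right 0) (\<lambda>r.
        INF p\<in>sphere (0::'a) 1 \<times> grassmannian (DIM('a) - m).
          packing_measure s (A \<inter> Xcone_r x r (snd p) \<alpha> - Hcone x (fst p) \<alpha>)
            / ennreal ((2 * r) powr s)))} = 0"
      by (simp add: \<Phi>_def[abs_def])
  qed
qed

end
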